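(* Let $\mathbf{w}_1,\dots,\mathbf{w}_n\in\mathbb{R}^n$ be linearly independent unit vectors and let $C=\mathfrak{c}(\mathbf{w}_1,\dots,\mathbf{w}_n)$. Then $C$ can be decomposed into a finite family of cones; that is, there exist finitely many cones $C_1,\dots,C_N\subseteq\mathbb{R}^n$ and signs $s_1,\dots,s_N\in\{\pm1\}$ such that $$[C]\equiv\sum_{m=1}^N s_m[C_m]\quad\text{modulo indicator functions of cones containing lines},$$ where each $C_m$ is either (I) a cone containing lines, or (II) a cone $\mathfrak{c}(\mathbf{v}_1,\dots,\mathbf{v}_n)$ of dimension $n$ whose associated matrix $M_n$ (with $(i,j)$ entry $-|\mathbf{v}_i\cdot\mathbf{v}_j|$ for $i\ne j$ and diagonal entries $1$) is positive definite; in particular: (a) $\|\mathbf{v}_i\|=1$ for $i=1,\dots,n$; (b) $\mathbf{v}_n=\mathbf{w}_n$; (c) $\langle\mathbf{v}_1,\dots,\mathbf{v}_{n-1}\rangle=\langle\mathbf{w}_1,\dots,\mathbf{w}_{n-1}\rangle$; (d) $\mathbf{v}_i\cdot\mathbf{v}_n=0$ for $i=1,\dots,n-2$; (e) there are signs $\epsilon_1,\dots,\epsilon_n\in\{\pm1\}$ such that $\mathbf{x}^TM_n\,\mathbf{x}=\left\|\begin{bmatrix}\epsilon_1\mathbf{v}_1,\dots,\epsilon_n\mathbf{v}_n\end{bmatrix}\mathbf{x}\right\|^2$ for every $\mathbf{x}\in\mathbb{R}^n$.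
   Context: $\mathfrak{c}(\mathbf{w}_1,\dots,\mathbf{w}_d)$ denotes the cone generated by the vectors $\mathbf{w}_1,\dots,\mathbf{w}_d$ (all nonnegative linear combinations), and $\langle\mathbf{w}_1,\dots,\mathbf{w}_d\rangle$ their linear span. Cones are polyhedral. $[C]$ denotes the indicator function of the cone $C$. A cone contains lines if it contains a one-dimensional linear subspace. The relation "$\equiv$ modulo indicator functions of cones containing lines" means that the difference of the two sides is a finite linear combination of indicator functions of polyhedral cones containing lines. In (e), $\begin{bmatrix}\epsilon_1\mathbf{v}_1,\dots,\epsilon_n\mathbf{v}_n\end{bmatrix}$ is the $n\times n$ matrix with columns $\epsilon_i\mathbf{v}_i$. *)

theory Defs
  imports "HOL-Analysis.Analysis"
begin

text \<open>
  Finite families \<open>w\<^sub>1, \<dots>, w\<^sub>d\<close> are functions on \<^typ>\<open>nat\<close> of which only the values at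
  \<open>1, \<dots>, d\<close> matter; the same convention is used for the entries of \<open>d \<times> d\<close> matrices and for
  coordinate vectors in \<open>\<real>\<^sup>d\<close> to which such matrices are applied.
\<close>

definition gen_cone :: "nat \<Rightarrow> (nat \<Rightarrow> 'a::real_vector) \<Rightarrow> 'a set" where
  "gen_cone d w = {\<Sum>i=1..d. a i *\<^sub>R w i | a. \<forall>i\<in>{1..d}. 0 \<le> a i}"

lemma gen_cone_eq_hull: "gen_cone d w = convex_cone hull (w ` {1..d})"
proof
  have cc: "convex_cone (gen_cone d w)"
    unfolding convex_cone_iff
  proof (intro conjI allI impI ballI)
    show "0 \<in> gen_cone d w"
      unfolding gen_cone_def by (rule CollectI, rule exI[of _ "\<lambda>_. 0"]) simp
  next
    fix x y assume "x \<in> gen_cone d w" "y \<in> gen_cone d w"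
    then obtain a b where "x = (\<Sum>i=1..d. a i *\<^sub>R w i)" "\<forall>i\<in>{1..d}. 0 \<le> a i"
      "y = (\<Sum>i=1..d. b i *\<^sub>R w i)" "\<forall>i\<in>{1..d}. 0 \<le> b i"
      unfolding gen_cone_def by blast
    then show "x + y \<in> gen_cone d w"
      unfolding gen_cone_def
      by (intro CollectI exI[of _ "\<lambda>i. a i + b i"]) (simp add: scaleR_add_left sum.distrib)
  next
    fix x and c :: real assume "x \<in> gen_cone d w" "0 \<le> c"
    then obtain a where "x = (\<Sum>i=1..d. a i *\<^sub>R w i)" "\<forall>i\<in>{1..d}. 0 \<le> a i"
      unfolding gen_cone_def by blast
    with \<open>0 \<le> c\<close> show "c *\<^sub>R x \<in> gen_cone d w"
      unfolding gen_cone_def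
      by (intro CollectI exI[of _ "\<lambda>i. c * a i"]) (simp add: scaleR_sum_right)
  qed
  have "w i \<in> gen_cone d w" if "i \<in> {1..d}" for i
  proof -
    have "(\<Sum>j=1..d. (if j = i then 1 else 0) *\<^sub>R w j) = (\<Sum>j=1..d. if j = i then w j else 0)"
      by (rule sum.cong) auto
    also have "\<dots> = w i"
      using that by simp
    finally show ?thesis
      unfolding gen_cone_def
      by (intro CollectI exI[of _ "\<lambda>j. if j = i then 1 else 0"]) simp
  qed
  then show "convex_cone hull (w ` {1..d}) \<subseteq> gen_cone d w"
    by (intro hull_minimal cc) blast
next
  let ?H = "convex_cone hull (w ` {1..d})"
  have H: "convex_cone ?H"
    by (rule convex_cone_convex_cone_hull)
  show "gen_cone d w \<subseteq> ?H"
  proof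
    fix x assume "x \<in> gen_cone d w"
    then obtain a where x: "x = (\<Sum>i=1..d. a i *\<^sub>R w i)" and a: "\<forall>i\<in>{1..d}. 0 \<le> a i"
      unfolding gen_cone_def by blast
    have "(\<Sum>i\<in>F. a i *\<^sub>R w i) \<in> ?H" if "finite F" "F \<subseteq> {1..d}" for F
      using that
    proof (induction F rule: finite_induct)
      case empty
      then show ?case using convex_cone_contains_0[OF H] by simp
    next
      case (insert i F)
      then have "a i *\<^sub>R w i \<in> ?H"
        using a by (intro convex_cone_scaleR[OF H]) (auto intro: hull_inc)
      with insert show ?case
        by (simp add: convex_cone_add[OF H] del: One_nat_def)
    qed
    then show "x \<in> ?H"
      unfolding x by simp
  qed
qed

text \<open>\<^const>\<open>convex_cone\<close> includes nonemptiness.\<close>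

definition polyhedral_cone :: "'a::euclidean_space set \<Rightarrow> bool" where
  "polyhedral_cone C \<longleftrightarrow> convex_cone C \<and> polyhedron C"

lemma polyhedral_cone_gen_cone:
  fixes w :: "nat \<Rightarrow> 'a::euclidean_space"
  shows "polyhedral_cone (gen_cone d w)"
  unfolding polyhedral_cone_def gen_cone_eq_hull
  by (intro conjI convex_cone_convex_cone_hull polyhedron_convex_cone_hull finite_imageI
      finite_atLeastAtMost)

definition contains_lines :: "'a::euclidean_space set \<Rightarrow> bool" where
  "contains_lines C \<longleftrightarrow> (\<exists>L. subspace L \<and> dim L = 1 \<and> L \<subseteq> C)"

definition equiv_mod_lines ::
    "('a::euclidean_space \<Rightarrow> real) \<Rightarrow> ('a \<Rightarrow> real) \<Rightarrow> bool" where
  "equiv_mod_lines f g \<longleftrightarrow>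
     (\<exists>\<D> a. finite \<D> \<and> (\<forall>D\<in>\<D>. polyhedral_cone D \<and> contains_lines D) \<and>
        (\<forall>x. f x - g x = (\<Sum>D\<in>\<D>. a D * indicat_real D x)))"

definition assoc_matrix :: "(nat \<Rightarrow> 'a::real_inner) \<Rightarrow> nat \<Rightarrow> nat \<Rightarrow> real" where
  "assoc_matrix v i j = (if i = j then 1 else - \<bar>v i \<bullet> v j\<bar>)"

definition quad_form :: "nat \<Rightarrow> (nat \<Rightarrow> nat \<Rightarrow> real) \<Rightarrow> (nat \<Rightarrow> real) \<Rightarrow> real" where
  "quad_form d M x = (\<Sum>i=1..d. x i * (\<Sum>j=1..d. M i j * x j))"

definition pos_definite :: "nat \<Rightarrow> (nat \<Rightarrow> nat \<Rightarrow> real) \<Rightarrow> bool" where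
  "pos_definite d M \<longleftrightarrow>
     (\<forall>i\<in>{1..d}. \<forall>j\<in>{1..d}. M i j = M j i) \<and>
     (\<forall>x. (\<exists>i\<in>{1..d}. x i \<noteq> 0) \<longrightarrow> 0 < quad_form d M x)"

text \<open>The product \<open>[u\<^sub>1, \<dots>, u\<^sub>d] x\<close> of the matrix with columns \<open>u\<^sub>1, \<dots>, u\<^sub>d\<close>, whose
  \<open>(r, j)\<close> entry is \<open>u j $ r\<close>, with the coordinate vector \<open>x\<close>.\<close>

definition columns_mult :: "nat \<Rightarrow> (nat \<Rightarrow> real ^ 'n) \<Rightarrow> (nat \<Rightarrow> real) \<Rightarrow> real ^ 'n" where
  "columns_mult d u x = (\<chi> r. \<Sum>j=1..d. u j $ r * x j)"

end

theory Submission
  imports Defs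
begin

text \<open>
  Let \<open>a\<close> assign a real number to each generator of a simplicial cone, at least one of them
  positive.  If \<open>b\<close> is the functional with \<open>b(w\<^sub>i) = a\<^sub>i\<close>, then modulo cones containing lines the cone
  is the sum over \<open>a\<^sub>i \<noteq> 0\<close>, with sign \<open>sgn a\<^sub>i\<close>, of the cones obtained by replacing the \<open>i\<close>-th defining
  inequality by \<open>b \<ge> 0\<close>; the generators other than \<open>\<plusminus>w\<^sub>i\<close> then become \<open>w\<^sub>j - (a\<^sub>j/a\<^sub>i) w\<^sub>i\<close>, on which \<open>b\<close>
  vanishes (Brion--Vergne).  Taking \<open>a\<^sub>i = \<plusminus>(w\<^sub>i \<bullet> w\<^sub>k)\<close> for \<open>i < k\<close> and \<open>a\<^sub>i = 0\<close> otherwise, for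
  \<open>k = n, n - 1, \<dots>\<close>, makes the Gram matrix tridiagonal.  Signs \<open>\<epsilon>\<^sub>i\<close> can then be chosen one
  after the other so that \<open>\<epsilon>\<^sub>i \<epsilon>\<^sub>j (v\<^sub>i \<bullet> v\<^sub>j) = -\<bar>v\<^sub>i \<bullet> v\<^sub>j\<bar>\<close> off the diagonal, so the associated matrix
  is the Gram matrix of the basis \<open>\<epsilon>\<^sub>i v\<^sub>i\<close>.
\<close>

section \<open>The relation modulo cones containing lines\<close>

lemma equiv_mod_lines_refl [simp]: "equiv_mod_lines f f"
  unfolding equiv_mod_lines_def by (intro exI[of _ "{}"]) simp

lemma equiv_mod_lines_add:
  assumes "equiv_mod_lines f g" "equiv_mod_lines h k"
  shows "equiv_mod_lines (\<lambda>x. f x + h x) (\<lambda>x. g x + k x)"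
proof -
  obtain A a where A: "finite A" "\<forall>D\<in>A. polyhedral_cone D \<and> contains_lines D"
    "\<And>x. f x - g x = (\<Sum>D\<in>A. a D * indicat_real D x)"
    using assms(1) unfolding equiv_mod_lines_def by blast
  obtain B b where B: "finite B" "\<forall>D\<in>B. polyhedral_cone D \<and> contains_lines D"
    "\<And>x. h x - k x = (\<Sum>D\<in>B. b D * indicat_real D x)"
    using assms(2) unfolding equiv_mod_lines_def by blast
  \<comment> \<open>A cone may occur in both families, so its two coefficients are added.\<close>
  define c where "c D = (if D \<in> A then a D else 0) + (if D \<in> B then b D else 0)" for D
  have "f x + h x - (g x + k x) = (\<Sum>D\<in>A \<union> B. c D * indicat_real D x)" for x
  proof -
    have "(\<Sum>D\<in>A \<union> B. c D * indicat_real D x)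
        = (\<Sum>D\<in>A \<union> B. (if D \<in> A then a D * indicat_real D x else 0))
          + (\<Sum>D\<in>A \<union> B. (if D \<in> B then b D * indicat_real D x else 0))"
      unfolding c_def sum.distrib[symmetric] by (intro sum.cong) (auto simp: algebra_simps)
    also have "\<dots> = (\<Sum>D\<in>A. a D * indicat_real D x) + (\<Sum>D\<in>B. b D * indicat_real D x)"
      using A(1) B(1) by (simp add: sum.inter_restrict[symmetric] Int_absorb1)
    finally show ?thesis using A(3)[of x] B(3)[of x] by simp
  qed
  with A(1,2) B(1,2) show ?thesis
    unfolding equiv_mod_lines_def by (intro exI[of _ "A \<union> B"] exI[of _ c]) auto
qed

lemma equiv_mod_lines_cmult:
  assumes "equiv_mod_lines f g"
  shows "equiv_mod_lines (\<lambda>x. c * f x) (\<lambda>x. c * g x)"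
proof -
  obtain A a where A: "finite A" "\<forall>D\<in>A. polyhedral_cone D \<and> contains_lines D"
    "\<And>x. f x - g x = (\<Sum>D\<in>A. a D * indicat_real D x)"
    using assms unfolding equiv_mod_lines_def by blast
  have "c * f x - c * g x = (\<Sum>D\<in>A. (c * a D) * indicat_real D x)" for x
    using A(3)[of x] by (simp add: sum_distrib_left mult.assoc flip: right_diff_distrib)
  with A(1,2) show ?thesis
    unfolding equiv_mod_lines_def
    by (intro exI[of _ A] exI[of _ "\<lambda>D. c * a D"]) auto
qed

lemma equiv_mod_lines_sum:
  assumes "\<And>i. i \<in> I \<Longrightarrow> equiv_mod_lines (f i) (g i)"
  shows "equiv_mod_lines (\<lambda>x. \<Sum>i\<in>I. f i x) (\<lambda>x. \<Sum>i\<in>I. g i x)"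
  using assms
  by (induction I rule: infinite_finite_induct) (auto intro!: equiv_mod_lines_add)

lemma equiv_mod_lines_trans:
  assumes "equiv_mod_lines f g" "equiv_mod_lines g h"
  shows "equiv_mod_lines f h"
  \<comment> \<open>In the difference of the two summed sides \<open>g\<close> cancels.\<close>
  using equiv_mod_lines_add[OF assms] by (simp add: equiv_mod_lines_def)

lemma equiv_mod_lines_indicat_null:
  assumes "polyhedral_cone C" "contains_lines C"
  shows "equiv_mod_lines (indicat_real C) (\<lambda>_. 0)"
  unfolding equiv_mod_lines_def
  by (intro exI[of _ "{C}"] exI[of _ "\<lambda>_. 1"]) (use assms in auto)

text \<open>Every defining functional vanishes on \<open>z\<close>, so the whole line through
  \<open>z\<close> lies in the cone. All negligible cones below arise in this way.\<close>

lemma equiv_mod_lines_halfspaces_null: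
  fixes Y :: "'a::euclidean_space set"
  assumes "finite Y" "z \<noteq> 0" "\<And>y. y \<in> Y \<Longrightarrow> y \<bullet> z = 0"
  shows "equiv_mod_lines (indicat_real {x. \<forall>y\<in>Y. 0 \<le> y \<bullet> x}) (\<lambda>_. 0)"
proof (rule equiv_mod_lines_indicat_null)
  let ?C = "{x. \<forall>y\<in>Y. 0 \<le> y \<bullet> x}"
  have eq: "?C = \<Inter>((\<lambda>y. {x. 0 \<le> y \<bullet> x}) ` Y)" by auto
  show "polyhedral_cone ?C"
    unfolding polyhedral_cone_def eq using assms(1)
    by (auto intro!: convex_cone_Inter convex_cone_halfspace_ge polyhedron_Inter
        polyhedron_halfspace_ge)
  have "span {z} \<subseteq> ?C" using assms(3) by (auto simp: span_singleton)
  moreover have "dim (span {z}) = 1" using assms(2) by (simp add: dim_singleton)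
  ultimately show "contains_lines ?C"
    unfolding contains_lines_def by blast
qed

section \<open>Signed decomposition with respect to a functional\<close>

text \<open>Expanding the product gives one term for each subset of \<open>A\<close>. Subsets
  missing two indices contribute negligible terms, which leaves \<open>A\<close> itself and the
  subsets missing exactly one index.\<close>

lemma equiv_mod_lines_prod_expand:
  fixes f :: "'i \<Rightarrow> 'a::euclidean_space \<Rightarrow> real"
  assumes A: "finite A"
    and null: "\<And>X i j. X \<subseteq> A - {i, j} \<Longrightarrow> i \<in> A \<Longrightarrow> j \<in> A \<Longrightarrow> i \<noteq> j \<Longrightarrow>
      equiv_mod_lines (\<lambda>x. u x * (\<Prod>k\<in>X. f k x)) (\<lambda>_. 0)"
  shows "equiv_mod_lines (\<lambda>x. u x * (\<Prod>k\<in>A. f k x - 1))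
    (\<lambda>x. u x * (\<Prod>k\<in>A. f k x) - (\<Sum>i\<in>A. u x * (\<Prod>k\<in>A - {i}. f k x)))"
proof -
  define R where "R = Pow A - insert A ((\<lambda>i. A - {i}) ` A)"
  have inj: "inj_on (\<lambda>i. A - {i}) A" by (auto simp: inj_on_def)
  have Pow: "Pow A = insert A ((\<lambda>i. A - {i}) ` A) \<union> R" unfolding R_def by auto
  have *: "u x * (\<Prod>k\<in>A. f k x - 1)
      = (u x * (\<Prod>k\<in>A. f k x) - (\<Sum>i\<in>A. u x * (\<Prod>k\<in>A - {i}. f k x)))
        + (\<Sum>X\<in>R. (-1) ^ (card A - card X) * (u x * (\<Prod>k\<in>X. f k x)))" for x
  proof -
    let ?t = "\<lambda>X. (-1) ^ (card A - card X) * (u x * (\<Prod>k\<in>X. f k x))"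
    have "u x * (\<Prod>k\<in>A. f k x - 1) = (\<Sum>X\<in>Pow A. ?t X)"
      unfolding prod_diff_conv_sum'[OF A] sum_distrib_left by (intro sum.cong) auto
    also have "\<dots> = sum ?t (insert A ((\<lambda>i. A - {i}) ` A)) + sum ?t R"
      unfolding Pow by (rule sum.union_disjoint) (use A in \<open>auto simp: R_def\<close>)
    also have "sum ?t (insert A ((\<lambda>i. A - {i}) ` A)) = ?t A + (\<Sum>i\<in>A. ?t (A - {i}))"
      by (subst sum.insert) (use A inj in \<open>auto simp: sum.reindex\<close>)
    also have "(\<Sum>i\<in>A. ?t (A - {i})) = (\<Sum>i\<in>A. - (u x * (\<Prod>k\<in>A - {i}. f k x)))"
    proof (rule sum.cong)
      fix i assume "i \<in> A"
      then have "card A - card (A - {i}) = 1"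
        using A card_gt_0_iff[of A] by (auto simp: card_Diff_singleton)
      then show "?t (A - {i}) = - (u x * (\<Prod>k\<in>A - {i}. f k x))" by simp
    qed simp
    finally show ?thesis by (simp add: sum_negf)
  qed
  have "equiv_mod_lines (\<lambda>x. \<Sum>X\<in>R. (-1) ^ (card A - card X) * (u x * (\<Prod>k\<in>X. f k x)))
      (\<lambda>x. \<Sum>X\<in>R. (-1) ^ (card A - card X) * 0)"
  proof (intro equiv_mod_lines_sum equiv_mod_lines_cmult)
    fix X assume X: "X \<in> R"
    then obtain i where i: "i \<in> A" "i \<notin> X" unfolding R_def by auto
    with X obtain j where "j \<in> A" "j \<notin> X" "i \<noteq> j" unfolding R_def by blast
    with i X show "equiv_mod_lines (\<lambda>x. u x * (\<Prod>k\<in>X. f k x)) (\<lambda>_. 0)"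
      by (intro null[of X i j]) (auto simp: R_def)
  qed
  from equiv_mod_lines_add[OF equiv_mod_lines_refl this]
  show ?thesis unfolding * by simp
qed

lemma dual_basis_coordinate:
  fixes w y :: "'i \<Rightarrow> 'a::real_inner"
  assumes "finite J" "j \<in> J"
    and dual: "\<And>i j. i \<in> J \<Longrightarrow> j \<in> J \<Longrightarrow> y i \<bullet> w j = (if i = j then 1 else 0)"
  shows "y j \<bullet> (\<Sum>i\<in>J. a i *\<^sub>R w i) = a j" "(\<Sum>i\<in>J. a i *\<^sub>R y i) \<bullet> w j = a j"
proof -
  have "(\<Sum>i\<in>J. a i * (y j \<bullet> w i)) = (\<Sum>i\<in>J. if i = j then a i else 0)"
    "(\<Sum>i\<in>J. a i * (y i \<bullet> w j)) = (\<Sum>i\<in>J. if i = j then a i else 0)"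
    by (rule sum.cong; simp add: dual assms(2))+
  then show "y j \<bullet> (\<Sum>i\<in>J. a i *\<^sub>R w i) = a j" "(\<Sum>i\<in>J. a i *\<^sub>R y i) \<bullet> w j = a j"
    using assms(1,2) by (simp_all add: inner_sum_right inner_sum_left)
qed

lemma prod_indicat:
  assumes "finite S"
  shows "(\<Prod>j\<in>S. indicat_real {x. P j x} x) = indicat_real {x. \<forall>j\<in>S. P j x} x"
  using assms by (induction S) (auto simp: indicator_def)

text \<open>Two products of indicators vanish identically, one carrying the factor for
  \<open>b \<ge> 0\<close> and one its complement. Expanded modulo cones containing lines, they
  express the two parts of the cone through cones with one inequality dropped; the claim follows by
  adding them.\<close>

lemma equiv_mod_lines_signed_decomposition:
  fixes w y :: "'i \<Rightarrow> 'a::euclidean_space" and a :: "'i \<Rightarrow> real"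
  assumes J: "finite J"
    and dual: "\<And>i j. i \<in> J \<Longrightarrow> j \<in> J \<Longrightarrow> y i \<bullet> w j = (if i = j then 1 else 0)"
    and pos: "\<exists>i\<in>J. 0 < a i"
  defines "b \<equiv> \<Sum>j\<in>J. a j *\<^sub>R y j"
  shows "equiv_mod_lines (indicat_real {x. \<forall>j\<in>J. 0 \<le> y j \<bullet> x})
    (\<lambda>x. \<Sum>i\<in>{i \<in> J. a i \<noteq> 0}.
       sgn (a i) * indicat_real {x. 0 \<le> b \<bullet> x \<and> (\<forall>j\<in>J - {i}. 0 \<le> y j \<bullet> x)} x)"
proof -
  define f where "f j x = indicat_real {x. 0 \<le> y j \<bullet> x} x" for j x
  define g where "g x = indicat_real {x. 0 \<le> b \<bullet> x} x" for x
  define F where "F S x = (\<Prod>j\<in>S. f j x)" for S x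
  define Kp where "Kp = {i \<in> J. 0 < a i}"
  define Km where "Km = {i \<in> J. a i < 0}"
  have fin: "finite Kp" "finite Km" and sub: "Kp \<subseteq> J" "Km \<subseteq> J"
    using J by (auto simp: Kp_def Km_def)
  have F_eq: "F S x = indicat_real {x. \<forall>j\<in>S. 0 \<le> y j \<bullet> x} x" if "S \<subseteq> J" for S x
    unfolding F_def f_def by (rule prod_indicat) (use J that finite_subset in blast)
  have gF_eq: "g x * F S x = indicat_real {x. 0 \<le> b \<bullet> x \<and> (\<forall>j\<in>S. 0 \<le> y j \<bullet> x)} x"
    if "S \<subseteq> J" for S x
    by (auto simp: F_eq[OF that] g_def indicator_def)
  have w_nz: "w i \<noteq> 0" if "i \<in> J" for i using dual[OF that that] by auto
  \<comment> \<open>Once the inequality at \<open>i\<close> is dropped, the direction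
    \<open>w i\<close> is free.\<close>
  have F_null: "equiv_mod_lines (F S) (\<lambda>_. 0)" if "S \<subseteq> J - {i}" "i \<in> J" for S i
  proof -
    have "equiv_mod_lines (indicat_real {x. \<forall>u\<in>y ` S. 0 \<le> u \<bullet> x}) (\<lambda>_. 0)"
      by (rule equiv_mod_lines_halfspaces_null[of _ "w i"])
        (use that J w_nz in \<open>auto simp: dual subset_iff intro: finite_subset\<close>)
    moreover have "S \<subseteq> J" using that by auto
    then have "F S = indicat_real {x. \<forall>u\<in>y ` S. 0 \<le> u \<bullet> x}"
      by (simp add: fun_eq_iff F_eq)
    ultimately show ?thesis by simp
  qed
  have b_w: "b \<bullet> w i = a i" if "i \<in> J" for i
    unfolding b_def by (rule dual_basis_coordinate(2)[OF J that dual])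
  have gF_null: "equiv_mod_lines (\<lambda>x. g x * F S x) (\<lambda>_. 0)"
    if "S \<subseteq> J - {i, k}" "i \<in> J" "k \<in> J" "i \<noteq> k" "a k \<noteq> 0" for S i k
  proof -
    \<comment> \<open>This direction in the plane of \<open>w i\<close> and \<open>w k\<close> is
      annihilated by \<open>b\<close>. Its pairing with \<open>y i\<close> is \<open>a k\<close>, so
      it is nonzero.\<close>
    define z where "z = a k *\<^sub>R w i - a i *\<^sub>R w k"
    have "y i \<bullet> z \<noteq> 0" using that by (simp add: z_def inner_diff_right dual)
    then have "z \<noteq> 0" by auto
    then have "equiv_mod_lines (indicat_real {x. \<forall>u\<in>insert b (y ` S). 0 \<le> u \<bullet> x}) (\<lambda>_. 0)"
      by (rule equiv_mod_lines_halfspaces_null[rotated])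
        (use that J in \<open>auto simp: z_def inner_diff_right b_w dual subset_iff intro: finite_subset\<close>)
    moreover have "S \<subseteq> J" using that by auto
    then have "(\<lambda>x. g x * F S x) = indicat_real {x. \<forall>u\<in>insert b (y ` S). 0 \<le> u \<bullet> x}"
      by (simp add: fun_eq_iff gF_eq)
    ultimately show ?thesis by simp
  qed
  have F_split: "F S x * F X x = F (S \<union> X) x" if "S \<inter> X = {}" "S \<subseteq> J" "X \<subseteq> J" for S X x
    unfolding F_def using that J by (intro prod.union_disjoint[symmetric]) (auto intro: finite_subset)
  have b_x: "b \<bullet> x = (\<Sum>j\<in>J. a j * (y j \<bullet> x))" for x
    by (simp add: b_def inner_sum_left)

  \<comment> \<open>Where all \<open>y j\<close> are negative on \<open>Kp\<close> and nonnegative elsewhere, \<open>b\<close> is negative.\<close>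
  have zero_p: "g x * F (J - Kp) x * (\<Prod>k\<in>Kp. f k x - 1) = 0" for x
  proof (rule ccontr)
    assume nz: "\<not> ?thesis"
    then have "0 \<le> b \<bullet> x" "\<forall>j\<in>J - Kp. 0 \<le> y j \<bullet> x"
      by (auto simp: F_eq g_def indicator_def split: if_splits)
    moreover have neg: "\<forall>j\<in>Kp. y j \<bullet> x < 0"
      using nz fin(1) by (auto simp: f_def indicator_def split: if_splits)
    moreover have "b \<bullet> x < 0"
    proof -
      obtain i where i: "i \<in> J" "0 < a i" using pos by blast
      have "(\<Sum>j\<in>J. a j * (y j \<bullet> x)) < (\<Sum>j\<in>J. 0)"
      proof (rule sum_strict_mono_ex1[OF J])
        show "\<forall>j\<in>J. a j * (y j \<bullet> x) \<le> 0"
        proof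
          fix j assume "j \<in> J"
          with calculation show "a j * (y j \<bullet> x) \<le> 0"
            by (cases "j \<in> Kp") (auto simp: Kp_def mult_le_0_iff not_less intro: less_imp_le)
        qed
        show "\<exists>j\<in>J. a j * (y j \<bullet> x) < 0"
          using i neg by (intro bexI[of _ i]) (auto simp: Kp_def mult_less_0_iff)
      qed
      then show ?thesis by (simp add: b_x)
    qed
    ultimately show False by simp
  qed
  \<comment> \<open>If all \<open>y j\<close> are negative on \<open>Km\<close> and nonnegative
    elsewhere, every term of \<open>b\<close> is nonnegative, so this cannot happen where
    \<open>b\<close> is negative.\<close>
  have zero_m: "(1 - g x) * F (J - Km) x * (\<Prod>k\<in>Km. f k x - 1) = 0" for x
  proof (rule ccontr)
    assume nz: "\<not> ?thesis"
    then have "b \<bullet> x < 0" "\<forall>j\<in>J - Km. 0 \<le> y j \<bullet> x"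
      by (auto simp: F_eq g_def indicator_def split: if_splits)
    moreover have "\<forall>j\<in>Km. y j \<bullet> x < 0"
      using nz fin(2) by (auto simp: f_def indicator_def split: if_splits)
    ultimately have "0 \<le> a j * (y j \<bullet> x)" if "j \<in> J" for j
      using that by (cases "j \<in> Km") (auto simp: Km_def mult_nonpos_nonpos)
    then have "0 \<le> (\<Sum>j\<in>J. a j * (y j \<bullet> x))" by (rule sum_nonneg)
    with \<open>b \<bullet> x < 0\<close> show False by (simp add: b_x)
  qed
  have J_p: "J - Kp \<union> Kp = J" "\<And>i. i \<in> Kp \<Longrightarrow> J - Kp \<union> (Kp - {i}) = J - {i}"
    and J_m: "J - Km \<union> Km = J" "\<And>i. i \<in> Km \<Longrightarrow> J - Km \<union> (Km - {i}) = J - {i}"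
    using sub by auto
  have "equiv_mod_lines (\<lambda>x. g x * F (J - Kp) x * (\<Prod>k\<in>Kp. f k x - 1))
    (\<lambda>x. g x * F (J - Kp) x * (\<Prod>k\<in>Kp. f k x)
       - (\<Sum>i\<in>Kp. g x * F (J - Kp) x * (\<Prod>k\<in>Kp - {i}. f k x)))"
  proof (rule equiv_mod_lines_prod_expand[OF fin(1)])
    fix X i j assume X: "X \<subseteq> Kp - {i, j}" "i \<in> Kp" "j \<in> Kp" "i \<noteq> j"
    have "equiv_mod_lines (\<lambda>x. g x * F (J - Kp \<union> X) x) (\<lambda>_. 0)"
      by (rule gF_null[of _ i j]) (use X in \<open>auto simp: Kp_def\<close>)
    then show "equiv_mod_lines (\<lambda>x. g x * F (J - Kp) x * (\<Prod>k\<in>X. f k x)) (\<lambda>_. 0)"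
      using X sub by (subst (asm) F_split[symmetric]) (auto simp: F_def mult.assoc)
  qed
  also have "(\<lambda>x. g x * F (J - Kp) x * (\<Prod>k\<in>Kp. f k x)
       - (\<Sum>i\<in>Kp. g x * F (J - Kp) x * (\<Prod>k\<in>Kp - {i}. f k x)))
     = (\<lambda>x. g x * F J x - (\<Sum>i\<in>Kp. g x * F (J - {i}) x))"
  proof -
    have "F (J - Kp) x * (\<Prod>k\<in>Kp. f k x) = F J x" for x
      using F_split[of "J - Kp" Kp x, unfolded J_p(1)] sub by (auto simp: F_def)
    moreover have "F (J - Kp) x * (\<Prod>k\<in>Kp - {i}. f k x) = F (J - {i}) x" if "i \<in> Kp" for i x
      using F_split[of "J - Kp" "Kp - {i}" x, unfolded J_p(2)[OF that]] sub by (auto simp: F_def)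
    ultimately show ?thesis by (simp add: mult.assoc)
  qed
  finally have p: "equiv_mod_lines (\<lambda>_. 0) (\<lambda>x. g x * F J x - (\<Sum>i\<in>Kp. g x * F (J - {i}) x))"
    by (simp add: zero_p)
  have "equiv_mod_lines (\<lambda>x. (1 - g x) * F (J - Km) x * (\<Prod>k\<in>Km. f k x - 1))
    (\<lambda>x. (1 - g x) * F (J - Km) x * (\<Prod>k\<in>Km. f k x)
       - (\<Sum>i\<in>Km. (1 - g x) * F (J - Km) x * (\<Prod>k\<in>Km - {i}. f k x)))"
  proof (rule equiv_mod_lines_prod_expand[OF fin(2)])
    fix X i j assume X: "X \<subseteq> Km - {i, j}" "i \<in> Km" "j \<in> Km" "i \<noteq> j"
    have "equiv_mod_lines (\<lambda>x. g x * F (J - Km \<union> X) x) (\<lambda>_. 0)"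
      by (rule gF_null[of _ i j]) (use X in \<open>auto simp: Km_def\<close>)
    moreover have "equiv_mod_lines (F (J - Km \<union> X)) (\<lambda>_. 0)"
      by (rule F_null[of _ i]) (use X in \<open>auto simp: Km_def\<close>)
    ultimately have "equiv_mod_lines
        (\<lambda>x. F (J - Km \<union> X) x + (-1) * (g x * F (J - Km \<union> X) x)) (\<lambda>x. 0 + (-1) * 0)"
      by (intro equiv_mod_lines_add equiv_mod_lines_cmult)
    moreover have "(J - Km) \<inter> X = {}" "X \<subseteq> J" using X sub by auto
    then have "F (J - Km \<union> X) x = F (J - Km) x * (\<Prod>k\<in>X. f k x)" for x
      using F_split[of "J - Km" X x] by (simp add: F_def)
    ultimately show "equiv_mod_lines (\<lambda>x. (1 - g x) * F (J - Km) x * (\<Prod>k\<in>X. f k x)) (\<lambda>_. 0)"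
      by (simp add: algebra_simps)
  qed
  also have "(\<lambda>x. (1 - g x) * F (J - Km) x * (\<Prod>k\<in>Km. f k x)
       - (\<Sum>i\<in>Km. (1 - g x) * F (J - Km) x * (\<Prod>k\<in>Km - {i}. f k x)))
     = (\<lambda>x. (1 - g x) * F J x - (\<Sum>i\<in>Km. (1 - g x) * F (J - {i}) x))"
  proof -
    have "F (J - Km) x * (\<Prod>k\<in>Km. f k x) = F J x" for x
      using F_split[of "J - Km" Km x, unfolded J_m(1)] sub by (auto simp: F_def)
    moreover have "F (J - Km) x * (\<Prod>k\<in>Km - {i}. f k x) = F (J - {i}) x" if "i \<in> Km" for i x
      using F_split[of "J - Km" "Km - {i}" x, unfolded J_m(2)[OF that]] sub by (auto simp: F_def)
    ultimately show ?thesis by (simp add: mult.assoc)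
  qed
  finally have m: "equiv_mod_lines (\<lambda>_. 0)
      (\<lambda>x. (1 - g x) * F J x - (\<Sum>i\<in>Km. (1 - g x) * F (J - {i}) x))"
    by (simp add: zero_m)
  \<comment> \<open>Without the factor \<open>g\<close>, a single dropped inequality already leaves
    a line in the cone.\<close>
  have s: "equiv_mod_lines (\<lambda>x. (-1) * (\<Sum>i\<in>Km. F (J - {i}) x)) (\<lambda>x. (-1) * (\<Sum>i\<in>Km. 0))"
    by (intro equiv_mod_lines_sum equiv_mod_lines_cmult)
      (rule F_null, use sub in auto)
  define G where "G x = (\<Sum>i\<in>{i \<in> J. a i \<noteq> 0}. sgn (a i) * (g x * F (J - {i}) x))" for x
  have G_eq: "G x = (\<Sum>i\<in>Kp. g x * F (J - {i}) x) - (\<Sum>i\<in>Km. g x * F (J - {i}) x)" for x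
  proof -
    have eq: "{i \<in> J. a i \<noteq> 0} = Kp \<union> Km" by (auto simp: Kp_def Km_def)
    have "G x = (\<Sum>i\<in>Kp. sgn (a i) * (g x * F (J - {i}) x))
        + (\<Sum>i\<in>Km. sgn (a i) * (g x * F (J - {i}) x))"
      unfolding G_def eq by (rule sum.union_disjoint) (use fin in \<open>auto simp: Kp_def Km_def\<close>)
    also have "\<dots> = (\<Sum>i\<in>Kp. g x * F (J - {i}) x) + (\<Sum>i\<in>Km. - (g x * F (J - {i}) x))"
      by (intro arg_cong2[where f = "(+)"] sum.cong) (auto simp: Kp_def Km_def)
    finally show ?thesis by (simp add: sum_negf)
  qed
  have "equiv_mod_lines (\<lambda>x. 0 + 0 + (-1) * (\<Sum>i\<in>Km. F (J - {i}) x))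
    (\<lambda>x. (g x * F J x - (\<Sum>i\<in>Kp. g x * F (J - {i}) x))
      + ((1 - g x) * F J x - (\<Sum>i\<in>Km. (1 - g x) * F (J - {i}) x)) + (-1) * (\<Sum>i\<in>Km. 0))"
    by (intro equiv_mod_lines_add p m s)
  \<comment> \<open>After multiplication by \<open>-1\<close> the difference of the two sides is
    exactly \<open>F J x - G x\<close>.\<close>
  then have "equiv_mod_lines (\<lambda>x. (-1) * ((-1) * (\<Sum>i\<in>Km. F (J - {i}) x)) + 0)
    (\<lambda>x. (-1) * ((F J x - G x) - (\<Sum>i\<in>Km. F (J - {i}) x)) + 0)"
    by (intro equiv_mod_lines_add equiv_mod_lines_cmult)
      (auto simp: G_eq algebra_simps sum.distrib sum_subtractf)
  then have "equiv_mod_lines (F J) G"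
    unfolding equiv_mod_lines_def by (simp add: algebra_simps)
  moreover have "F J = indicat_real {x. \<forall>j\<in>J. 0 \<le> y j \<bullet> x}"
    by (simp add: fun_eq_iff F_eq)
  ultimately show ?thesis
    unfolding G_def gF_eq[OF Diff_subset] by simp
qed

section \<open>Dual bases and simplicial cones\<close>

text \<open>A count: as many spanning vectors as the dimension leave no room for repetition or
  dependence. Hence it suffices to follow spans through the construction.\<close>

lemma spanning_family_basis:
  fixes w :: "'i \<Rightarrow> 'a::euclidean_space"
  assumes J: "finite J" "card J = DIM('a)" and span: "span (w ` J) = UNIV"
  shows "independent (w ` J)" "inj_on w J"
proof -
  have le: "card (w ` J) \<le> DIM('a)" using J card_image_le by metis
  then show "independent (w ` J)"
    using J span by (intro card_le_dim_spanning[of _ UNIV]) auto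
  have "DIM('a) \<le> card (w ` J)"
    using dim_le_card[of UNIV "w ` J"] J span by simp
  with le J show "inj_on w J" by (intro eq_card_imp_inj_on) auto
qed

lemma dual_basis_exists:
  fixes w :: "'i \<Rightarrow> 'a::euclidean_space"
  assumes "independent (w ` J)" "inj_on w J"
  obtains y where "\<And>i j. i \<in> J \<Longrightarrow> j \<in> J \<Longrightarrow> y i \<bullet> w j = (if i = j then 1 else 0)"
proof -
  have "\<exists>y. \<forall>j\<in>J. y \<bullet> w j = (if i = j then 1 else 0)" if "i \<in> J" for i
  proof -
    obtain f :: "'a \<Rightarrow> real" where f: "linear f" "\<forall>x\<in>w ` J. f x = (if x = w i then 1 else 0)"
      using linear_independent_extend[OF assms(1), of "\<lambda>x. if x = w i then 1 else 0 :: real"]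
      by auto
    \<comment> \<open>\<open>adjoint f 1\<close> is the vector that represents the functional
      \<open>f\<close>.\<close>
    have "adjoint f 1 \<bullet> w j = (if i = j then 1 else 0)" if "j \<in> J" for j
      using f(2) that \<open>i \<in> J\<close> inj_onD[OF assms(2)] adjoint_works[OF f(1), of "w j" 1]
      by (auto simp: inner_commute)
    then show ?thesis by blast
  qed
  then obtain y where "\<forall>i\<in>J. \<forall>j\<in>J. y i \<bullet> w j = (if i = j then 1 else 0)" by metis
  then show ?thesis using that by blast
qed

text \<open>The coordinates of \<open>x\<close> in the basis \<open>w\<close> are the numbers
  \<open>y j \<bullet> x\<close>. This passes from generators to the inequalities in which the
  signed decomposition is stated.\<close>

lemma gen_cone_dual:
  fixes w y :: "nat \<Rightarrow> 'a::euclidean_space"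
  assumes span: "span (w ` {1..n}) = UNIV"
    and dual: "\<And>i j. i \<in> {1..n} \<Longrightarrow> j \<in> {1..n} \<Longrightarrow> y i \<bullet> w j = (if i = j then 1 else 0)"
  shows "gen_cone n w = {x. \<forall>j\<in>{1..n}. 0 \<le> y j \<bullet> x}"
proof -
  note coord = dual_basis_coordinate(1)[OF finite_atLeastAtMost _ dual]
  have expand: "x = (\<Sum>j=1..n. (y j \<bullet> x) *\<^sub>R w j)" for x
  proof (rule linear_eq_on[of "\<lambda>x. x" "\<lambda>x. \<Sum>j=1..n. (y j \<bullet> x) *\<^sub>R w j" x "w ` {1..n}"])
    show "linear (\<lambda>x. \<Sum>j=1..n. (y j \<bullet> x) *\<^sub>R w j)"
      by (intro linear_compose_sum ballI linearI) (auto simp: inner_add_right scaleR_add_left)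
    fix b assume "b \<in> w ` {1..n}"
    then obtain i where i: "i \<in> {1..n}" "b = w i" by blast
    have "(\<Sum>j=1..n. (y j \<bullet> w i) *\<^sub>R w j) = (\<Sum>j=1..n. if j = i then w j else 0)"
      by (rule sum.cong) (simp_all only: dual i(1)
        scaleR_one scaleR_zero_left if_distrib[of "\<lambda>c. c *\<^sub>R _"])
    also have "\<dots> = w i" by (simp only: sum.delta finite_atLeastAtMost i(1) if_True)
    finally show "b = (\<Sum>j=1..n. (y j \<bullet> b) *\<^sub>R w j)" by (simp only: i(2))
  qed (use span in \<open>auto intro: linear_ident\<close>)
  show ?thesis
  proof (intro set_eqI iffI)
    fix x assume "x \<in> {x. \<forall>j\<in>{1..n}. 0 \<le> y j \<bullet> x}"
    then show "x \<in> gen_cone n w"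
      unfolding gen_cone_def using expand[of x]
      by (intro CollectI exI[of _ "\<lambda>j. y j \<bullet> x"]) auto
  next
    fix x assume "x \<in> gen_cone n w"
    then show "x \<in> {x. \<forall>j\<in>{1..n}. 0 \<le> y j \<bullet> x}"
      unfolding gen_cone_def using coord by (auto simp del: atLeastAtMost_iff)
  qed
qed

text \<open>For \<open>a i \<noteq> 0\<close>, the functional with values \<open>a j\<close> on
  \<open>w j\<close> takes the value \<open>\<bar>a i\<bar>\<close> on the vector at
  \<open>i\<close>, thanks to the factor \<open>sgn (a i)\<close>, and vanishes on the
  others.\<close>

definition shear ::
    "('i \<Rightarrow> 'a::real_vector) \<Rightarrow> ('i \<Rightarrow> real) \<Rightarrow> 'i \<Rightarrow> 'i \<Rightarrow> 'a" where
  "shear w a i j = (if j = i then sgn (a i) *\<^sub>R w i else w j - (a j / a i) *\<^sub>R w i)"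

text \<open>An invertible column operation, undone by recovering \<open>w i\<close> first. The index
  set is arbitrary because spans of initial segments must be preserved along with the full
  span.\<close>

lemma span_shear:
  assumes "i \<in> S" "a i \<noteq> 0"
  shows "span (shear w a i ` S) = span (w ` S)"
proof -
  have w: "w j \<in> span (w ` S)" if "j \<in> S" for j using that by (simp add: span_base)
  have s: "shear w a i j \<in> span (shear w a i ` S)" if "j \<in> S" for j
    using that by (simp add: span_base)
  have wi: "w i = sgn (a i) *\<^sub>R shear w a i i"
    using assms(2) by (simp add: shear_def sgn_if)
  have wi_in: "w i \<in> span (shear w a i ` S)"
    by (subst wi) (intro span_scale s assms)
  have "w j \<in> span (shear w a i ` S)" if "j \<in> S" for j
  proof (cases "j = i")
    case False
    then have "w j = shear w a i j + (a j / a i) *\<^sub>R w i" by (simp add: shear_def)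
    then show ?thesis using that s wi_in by (metis span_add span_scale)
  qed (use wi_in in simp)
  moreover have "shear w a i j \<in> span (w ` S)" if "j \<in> S" for j
    unfolding shear_def using that assms(1) by (auto intro!: span_diff span_scale w)
  ultimately show ?thesis by (subst span_eq) auto
qed

lemma gen_cone_signed_decomposition:
  fixes w :: "nat \<Rightarrow> 'a::euclidean_space"
  assumes n: "n = DIM('a)" and span: "span (w ` {1..n}) = UNIV"
    and pos: "\<exists>i\<in>{1..n}. 0 < a i"
  shows "equiv_mod_lines (indicat_real (gen_cone n w))
    (\<lambda>x. \<Sum>i\<in>{i \<in> {1..n}. a i \<noteq> 0}. sgn (a i) * indicat_real (gen_cone n (shear w a i)) x)"
proof -
  define J where "J = {1..n}"
  have J: "finite J" "card J = DIM('a)" by (simp_all add: J_def n)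
  have span_J: "span (w ` J) = UNIV" using span by (simp only: J_def)
  obtain y where dual: "\<And>i j. i \<in> J \<Longrightarrow> j \<in> J \<Longrightarrow> y i \<bullet> w j = (if i = j then 1 else 0)"
    using dual_basis_exists[OF spanning_family_basis[OF J span_J]] by blast
  define b where "b = (\<Sum>j\<in>J. a j *\<^sub>R y j)"
  have b_w: "b \<bullet> w i = a i" if "i \<in> J" for i
    unfolding b_def by (rule dual_basis_coordinate(2)[OF J(1) that dual])
  have cone: "gen_cone n (shear w a i) = {x. 0 \<le> b \<bullet> x \<and> (\<forall>j\<in>J - {i}. 0 \<le> y j \<bullet> x)}"
    if i: "i \<in> J" "a i \<noteq> 0" for i
  proof -
    \<comment> \<open>The dual basis of the sheared generators: only the functional at
      \<open>i\<close> changes, and it becomes \<open>b\<close> up to a positive factor.\<close>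
    define y' where "y' j = (if j = i then b /\<^sub>R \<bar>a i\<bar> else y j)" for j
    have "span (shear w a i ` J) = UNIV" using span_shear[of i J a w] i span_J by simp
    moreover have "y' j \<bullet> shear w a i k = (if j = k then 1 else 0)" if "j \<in> J" "k \<in> J" for j k
      using i that by (simp add: y'_def shear_def b_w dual inner_diff_right sgn_if)
    ultimately have "gen_cone n (shear w a i) = {x. \<forall>j\<in>J. 0 \<le> y' j \<bullet> x}"
      unfolding J_def by (rule gen_cone_dual)
    also have "\<dots> = {x. 0 \<le> y' i \<bullet> x \<and> (\<forall>j\<in>J - {i}. 0 \<le> y' j \<bullet> x)}"
      using i(1) by blast
    also have "\<dots> = {x. 0 \<le> b \<bullet> x \<and> (\<forall>j\<in>J - {i}. 0 \<le> y j \<bullet> x)}"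
      using i(2) by (simp add: y'_def zero_le_mult_iff)
    finally show ?thesis .
  qed
  have "equiv_mod_lines (indicat_real {x. \<forall>j\<in>J. 0 \<le> y j \<bullet> x})
    (\<lambda>x. \<Sum>i\<in>{i \<in> J. a i \<noteq> 0}.
       sgn (a i) * indicat_real {x. 0 \<le> b \<bullet> x \<and> (\<forall>j\<in>J - {i}. 0 \<le> y j \<bullet> x)} x)"
    unfolding b_def
    by (rule equiv_mod_lines_signed_decomposition[OF J(1) dual]) (use pos in \<open>auto simp only: J_def\<close>)
  also have "{x. \<forall>j\<in>J. 0 \<le> y j \<bullet> x} = gen_cone n w"
    using gen_cone_dual[OF span dual[unfolded J_def]] by (simp only: J_def)
  also have "(\<lambda>x. \<Sum>i\<in>{i \<in> J. a i \<noteq> 0}.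
       sgn (a i) * indicat_real {x. 0 \<le> b \<bullet> x \<and> (\<forall>j\<in>J - {i}. 0 \<le> y j \<bullet> x)} x)
    = (\<lambda>x. \<Sum>i\<in>{i \<in> J. a i \<noteq> 0}. sgn (a i) * indicat_real (gen_cone n (shear w a i)) x)"
    by (intro ext sum.cong refl arg_cong2[where f = times] arg_cong2[where f = indicat_real])
      (use cone in blast)
  finally show ?thesis unfolding J_def .
qed

section \<open>Signed sums of cones of a given kind\<close>

text \<open>Coefficients are signs, as the theorem demands, while cones containing lines are
  absorbed by \<open>equiv_mod_lines\<close>; \<open>P\<close> describes the cones that are
  listed.\<close>

definition signed_cone_sum :: "('a::euclidean_space set \<Rightarrow> bool) \<Rightarrow> ('a \<Rightarrow> real) \<Rightarrow> bool" where
  "signed_cone_sum P f \<longleftrightarrow> (\<exists>(N::nat) C s. (\<forall>m\<in>{1..N}. s m \<in> {1, -1 :: real} \<and> P (C m)) \<and>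
     equiv_mod_lines f (\<lambda>x. \<Sum>m=1..N. s m * indicat_real (C m) x))"

lemma signed_cone_sum_indicat: "P C \<Longrightarrow> signed_cone_sum P (indicat_real C)"
  unfolding signed_cone_sum_def
  by (intro exI[of _ "1::nat"] exI[of _ "\<lambda>_. C"] exI[of _ "\<lambda>_. 1"]) simp

lemma signed_cone_sum_zero: "signed_cone_sum P (\<lambda>_. 0)"
  unfolding signed_cone_sum_def by (intro exI[of _ "0::nat"]) simp

lemma signed_cone_sum_equiv:
  "equiv_mod_lines f g \<Longrightarrow> signed_cone_sum P g \<Longrightarrow> signed_cone_sum P f"
  unfolding signed_cone_sum_def by (meson equiv_mod_lines_trans)

lemma signed_cone_sum_mono:
  "signed_cone_sum P f \<Longrightarrow> (\<And>C. P C \<Longrightarrow> Q C) \<Longrightarrow> signed_cone_sum Q f"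
  unfolding signed_cone_sum_def by meson

lemma signed_cone_sum_add:
  assumes "signed_cone_sum P f" "signed_cone_sum P g"
  shows "signed_cone_sum P (\<lambda>x. f x + g x)"
proof -
  obtain N :: nat and C s where 1: "\<forall>m\<in>{1..N}. s m \<in> {1, -1 :: real} \<and> P (C m)"
    "equiv_mod_lines f (\<lambda>x. \<Sum>m=1..N. s m * indicat_real (C m) x)"
    using assms(1) unfolding signed_cone_sum_def by blast
  obtain M :: nat and D t where 2: "\<forall>m\<in>{1..M}. t m \<in> {1, -1 :: real} \<and> P (D m)"
    "equiv_mod_lines g (\<lambda>x. \<Sum>m=1..M. t m * indicat_real (D m) x)"
    using assms(2) unfolding signed_cone_sum_def by blast
  \<comment> \<open>Concatenation: positions beyond \<open>N\<close> list the second family, shifted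
    by \<open>N\<close>.\<close>
  define E where "E m = (if m \<le> N then C m else D (m - N))" for m
  define u where "u m = (if m \<le> N then s m else t (m - N))" for m
  have "(\<Sum>m=1..N + M. u m * indicat_real (E m) x)
      = (\<Sum>m=1..N. s m * indicat_real (C m) x) + (\<Sum>m=1..M. t m * indicat_real (D m) x)" for x
  proof -
    have "(\<Sum>m=N + 1..N + M. u m * indicat_real (E m) x) = (\<Sum>m=1..M. t m * indicat_real (D m) x)"
      by (rule sum.reindex_bij_witness[of _ "\<lambda>m. m + N" "\<lambda>m. m - N"]) (auto simp: u_def E_def)
    moreover have "(\<Sum>m=1..N. u m * indicat_real (E m) x) = (\<Sum>m=1..N. s m * indicat_real (C m) x)"
      by (intro sum.cong) (auto simp: u_def E_def)
    ultimately show ?thesis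
      by (simp only: sum.ub_add_nat[of 1 N _ M] le_add2)
  qed
  with equiv_mod_lines_add[OF 1(2) 2(2)]
  have "equiv_mod_lines (\<lambda>x. f x + g x) (\<lambda>x. \<Sum>m=1..N + M. u m * indicat_real (E m) x)" by simp
  moreover have "\<forall>m\<in>{1..N + M}. u m \<in> {1, -1} \<and> P (E m)"
  proof
    fix m assume "m \<in> {1..N + M}"
    moreover have "m - N \<in> {1..M}" if "\<not> m \<le> N"
      using that calculation by auto
    ultimately show "u m \<in> {1, -1} \<and> P (E m)"
      using bspec[OF 1(1), of m] bspec[OF 2(1), of "m - N"]
      by (cases "m \<le> N") (auto simp: u_def E_def)
  qed
  ultimately show ?thesis unfolding signed_cone_sum_def by blast
qed

lemma signed_cone_sum_sum:
  assumes "\<And>i. i \<in> I \<Longrightarrow> signed_cone_sum P (f i)"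
  shows "signed_cone_sum P (\<lambda>x. \<Sum>i\<in>I. f i x)"
  using assms
  by (induction I rule: infinite_finite_induct)
    (auto intro: signed_cone_sum_zero signed_cone_sum_add)

lemma signed_cone_sum_sign:
  assumes "signed_cone_sum P f" "c \<in> {1, -1}"
  shows "signed_cone_sum P (\<lambda>x. c * f x)"
proof -
  obtain N :: nat and C s where 1: "\<forall>m\<in>{1..N}. s m \<in> {1, -1 :: real} \<and> P (C m)"
    "equiv_mod_lines f (\<lambda>x. \<Sum>m=1..N. s m * indicat_real (C m) x)"
    using assms(1) unfolding signed_cone_sum_def by blast
  have "equiv_mod_lines (\<lambda>x. c * f x) (\<lambda>x. \<Sum>m=1..N. (c * s m) * indicat_real (C m) x)"
    using equiv_mod_lines_cmult[OF 1(2), of c] by (simp only: sum_distrib_left mult.assoc)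
  moreover have "\<forall>m\<in>{1..N}. c * s m \<in> {1, -1} \<and> P (C m)"
    using 1(1) assms(2) by auto
  ultimately show ?thesis
    unfolding signed_cone_sum_def by (intro exI[of _ N] exI[of _ C] exI[of _ "\<lambda>m. c * s m"]) simp
qed

section \<open>Tridiagonal Gram matrices\<close>

text \<open>Each \<open>x\<close> is the nonnegative multiple \<open>norm x\<close> of
  \<open>sgn x\<close>. This allows unit length to be restored after a shear without changing the
  cone.\<close>

lemma convex_cone_hull_sgn:
  fixes S :: "'a::real_normed_vector set"
  shows "convex_cone hull (sgn ` S) = convex_cone hull S"
proof (rule antisym)
  have "sgn x \<in> convex_cone hull S" if "x \<in> S" for x
    unfolding sgn_div_norm
    using that by (intro convex_cone_scaleR convex_cone_convex_cone_hull hull_inc) auto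
  then show "convex_cone hull (sgn ` S) \<subseteq> convex_cone hull S"
    by (intro hull_minimal convex_cone_convex_cone_hull) auto
  have "x \<in> convex_cone hull (sgn ` S)" if "x \<in> S" for x
  proof -
    have "norm x *\<^sub>R sgn x \<in> convex_cone hull (sgn ` S)"
      using that by (intro convex_cone_scaleR convex_cone_convex_cone_hull hull_inc) auto
    then show ?thesis by (cases "x = 0") (simp_all add: sgn_div_norm)
  qed
  then show "convex_cone hull S \<subseteq> convex_cone hull (sgn ` S)"
    by (intro hull_minimal convex_cone_convex_cone_hull) auto
qed

lemma span_sgn:
  fixes S :: "'a::real_normed_vector set"
  shows "span (sgn ` S) = span S"
proof -
  have "sgn x \<in> span S" if "x \<in> S" for x
    unfolding sgn_div_norm using that by (intro span_scale span_base)
  moreover have "x \<in> span (sgn ` S)" if "x \<in> S" for x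
  proof -
    have "norm x *\<^sub>R sgn x \<in> span (sgn ` S)"
      using that by (intro span_scale span_base) auto
    then show ?thesis by (cases "x = 0") (simp_all add: sgn_div_norm)
  qed
  ultimately show ?thesis by (subst span_eq) auto
qed

text \<open>Spanning stands for being a basis: it is equivalent when \<open>n\<close> is the
  dimension, and it is easy to transport through shears.\<close>

definition unit_basis :: "nat \<Rightarrow> (nat \<Rightarrow> 'a::euclidean_space) \<Rightarrow> bool" where
  "unit_basis n w \<longleftrightarrow> span (w ` {1..n}) = UNIV \<and> (\<forall>i\<in>{1..n}. norm (w i) = 1)"

text \<open>Only Gram matrix columns beyond \<open>k\<close> are constrained: the condition is void
  at \<open>k = n\<close> and says that the whole Gram matrix is tridiagonal at
  \<open>k = 0\<close>.\<close>

definition tridiagonal_above :: "nat \<Rightarrow> nat \<Rightarrow> (nat \<Rightarrow> 'a::euclidean_space) \<Rightarrow> bool" where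
  "tridiagonal_above k n w \<longleftrightarrow>
     (\<forall>i j. 1 \<le> i \<and> i + 2 \<le> j \<and> k < j \<and> j \<le> n \<longrightarrow> w i \<bullet> w j = 0)"

text \<open>The index \<open>i\<close> is moved to position \<open>k\<close>: after shearing by \<open>\<plusminus>(w l \<bullet> w (Suc k))\<close> the
  vector at \<open>i\<close> is the only one among the first \<open>k\<close> not orthogonal to \<open>w (Suc k)\<close>.\<close>

lemma tridiagonal_above_shear:
  fixes w :: "nat \<Rightarrow> 'a::euclidean_space"
  assumes n: "n = DIM('a)" and k: "Suc k \<le> n" and w: "unit_basis n w" "tridiagonal_above (Suc k) n w"
    and a: "\<And>l. l \<in> {1..k} \<Longrightarrow> a l = \<sigma> * (w l \<bullet> w (Suc k))" "\<And>l. k < l \<Longrightarrow> a l = 0"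
    and \<sigma>: "\<sigma> \<noteq> 0" and i: "i \<in> {1..k}" "a i \<noteq> 0"
  defines "v \<equiv> \<lambda>j. sgn (shear w a i (Transposition.transpose i k j))"
  shows "unit_basis n v" "tridiagonal_above k n v"
    and "gen_cone n v = gen_cone n (shear w a i)"
    and "\<And>j. k < j \<Longrightarrow> j \<le> n \<Longrightarrow> v j = w j"
    and "span (v ` {1..k}) = span (w ` {1..k})"
proof -
  let ?\<tau> = "Transposition.transpose i k"
  \<comment> \<open>The transposition moves only indices up to \<open>k\<close>, so it permutes
    every longer initial segment.\<close>
  have \<tau>: "?\<tau> ` {1..m} = {1..m}" if "k \<le> m" for m
    using that i by (intro transpose_image_eq) auto
  have image: "v ` {1..m} = sgn ` shear w a i ` {1..m}" if "k \<le> m" for m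
  proof -
    have "v ` {1..m} = sgn ` shear w a i ` ?\<tau> ` {1..m}" by (simp add: v_def image_image)
    then show ?thesis by (simp only: \<tau>[OF that])
  qed
  have span: "span (v ` {1..m}) = span (w ` {1..m})" if "k \<le> m" for m
    unfolding image[OF that] span_sgn using i that by (intro span_shear) auto
  show "span (v ` {1..k}) = span (w ` {1..k})" by (rule span) simp
  show "gen_cone n v = gen_cone n (shear w a i)"
    using image[of n] k by (simp only: gen_cone_eq_hull convex_cone_hull_sgn)
  \<comment> \<open>Beyond \<open>k\<close> the coefficient \<open>a j\<close> is zero, so the shear
    fixes \<open>w j\<close>, and normalising a unit vector changes nothing.\<close>
  show v_eq: "v j = w j" if "k < j" "j \<le> n" for j
  proof -
    have "norm (w j) = 1" using w(1) that by (auto simp: unit_basis_def)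
    moreover have "?\<tau> j = j" using i that by (simp add: Transposition.transpose_def)
    moreover have "j \<noteq> i" using i that by auto
    ultimately show ?thesis using that(1) by (simp only: v_def shear_def a(2) sgn_div_norm) simp
  qed
  have span_n: "span (v ` {1..n}) = UNIV"
    using span[OF Suc_leD[OF k]] w(1) by (simp only: unit_basis_def)
  have "norm (v j) = 1" if "j \<in> {1..n}" for j
  proof -
    have "independent (v ` {1..n})"
      using spanning_family_basis[OF _ _ span_n] n by auto
    then have "v j \<noteq> 0" using that dependent_zero by (metis imageI)
    then show ?thesis by (auto simp: v_def norm_sgn sgn_zero_iff)
  qed
  with span_n show "unit_basis n v" by (simp add: unit_basis_def)
  have orth_w: "w l \<bullet> w j = 0" if "1 \<le> l" "l + 2 \<le> j" "Suc k < j" "j \<le> n" for l j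
    using w(2) that by (auto simp: tridiagonal_above_def)
  have orth_v: "v l \<bullet> x = 0" if "shear w a i (?\<tau> l) \<bullet> x = 0" for l x
    using that by (simp add: v_def sgn_div_norm)
  show "tridiagonal_above k n v"
    unfolding tridiagonal_above_def
  proof (intro allI impI, elim conjE)
    fix l j assume l: "1 \<le> l" "l + 2 \<le> j" "k < j" "j \<le> n"
    show "v l \<bullet> v j = 0"
    proof (cases "k < l")
      case True
      then show ?thesis using l v_eq orth_w by simp
    next
      case False
      then have m: "1 \<le> ?\<tau> l" "?\<tau> l \<le> k"
        using l i by (auto simp: Transposition.transpose_def)
      have "shear w a i (?\<tau> l) \<bullet> w j = 0"
      proof (cases "j = Suc k")
        case True
        \<comment> \<open>The transposition sends only \<open>k\<close> to \<open>i\<close>, and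
          \<open>l + 2 \<le> j\<close> excludes \<open>l = k\<close>. At all other indices the shear
          cancels the inner product with \<open>w (Suc k)\<close>.\<close>
        then have ne: "?\<tau> l \<noteq> i" using l i by (auto simp: Transposition.transpose_def)
        have "w (?\<tau> l) \<bullet> w j = a (?\<tau> l) / \<sigma>" "w i \<bullet> w j = a i / \<sigma>"
          using a(1)[of "?\<tau> l"] a(1)[OF i(1)] m \<sigma> True by simp_all
        with ne i(2) show ?thesis by (simp add: shear_def inner_diff_left)
      next
        case False
        \<comment> \<open>For later columns both vectors entering the shear are already orthogonal
          to \<open>w j\<close>.\<close>
        then have "k + 2 \<le> j" "Suc k < j" using l by linarith+
        then have "w (?\<tau> l) \<bullet> w j = 0" "w i \<bullet> w j = 0"
          using orth_w[of "?\<tau> l" j] orth_w[of i j] m i(1) l(4) by simp_all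
        then show ?thesis by (simp add: shear_def inner_diff_left)
      qed
      then show ?thesis using orth_v v_eq l by simp
    qed
  qed
qed

section \<open>Clearing the Gram matrix column by column\<close>

text \<open>Clearing column \<open>k\<close> alters only generators before it, hence the last two
  conditions; at \<open>k = n\<close> they become (b) and (c). For \<open>k = 0\<close> the
  truncated \<open>k - 1\<close> gives an empty segment.\<close>

definition tridiagonal_refinement ::
    "nat \<Rightarrow> nat \<Rightarrow> (nat \<Rightarrow> 'a::euclidean_space) \<Rightarrow> 'a set \<Rightarrow> bool" where
  "tridiagonal_refinement k n w C \<longleftrightarrow>
     (\<exists>v. C = gen_cone n v \<and> unit_basis n v \<and> tridiagonal_above 0 n v \<and>
        (\<forall>j. k \<le> j \<and> 1 \<le> j \<and> j \<le> n \<longrightarrow> v j = w j) \<and>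
        span (v ` {1..k - 1}) = span (w ` {1..k - 1}))"

text \<open>Composes one reduction from \<open>w\<close> to \<open>u\<close> with a refinement of
  \<open>u\<close>. The refinement keeps \<open>u k\<close>, so equality of spans extends from the
  first \<open>k - 1\<close> vectors to the first \<open>k\<close>.\<close>

lemma tridiagonal_refinement_Suc:
  assumes "tridiagonal_refinement k n u C" and k: "Suc k \<le> n"
    and u: "\<And>j. k < j \<Longrightarrow> j \<le> n \<Longrightarrow> u j = w j" "span (u ` {1..k}) = span (w ` {1..k})"
  shows "tridiagonal_refinement (Suc k) n w C"
proof -
  obtain v where v: "C = gen_cone n v" "unit_basis n v" "tridiagonal_above 0 n v"
    and v_eq: "\<And>j. k \<le> j \<Longrightarrow> 1 \<le> j \<Longrightarrow> j \<le> n \<Longrightarrow> v j = u j"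
    and span: "span (v ` {1..k - 1}) = span (u ` {1..k - 1})"
    using assms(1) unfolding tridiagonal_refinement_def by blast
  have "span (v ` {1..k}) = span (u ` {1..k})"
  proof (cases "k = 0")
    case False
    then have "{1..k} = insert k {1..k - 1}" by auto
    moreover have "v k = u k" using v_eq False k by simp
    ultimately show ?thesis using span by (simp only: image_insert span_insert)
  qed simp
  moreover have "v j = w j" if "Suc k \<le> j" "1 \<le> j" "j \<le> n" for j
    using v_eq[of j] u(1)[of j] that by simp
  ultimately show ?thesis
    unfolding tridiagonal_refinement_def diff_Suc_1 u(2)[symmetric] using v
    by (intro exI[of _ v]) simp
qed

text \<open>Induction on the number of columns still to be cleared. The step makes
  \<open>w (Suc k)\<close> orthogonal to the first \<open>k - 1\<close> vectors, by a signed
  decomposition if necessary, and passes each resulting cone to the hypothesis.\<close>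

lemma tridiagonal_decomposition:
  fixes w :: "nat \<Rightarrow> 'a::euclidean_space"
  assumes n: "n = DIM('a)" and "k \<le> n" "unit_basis n w" "tridiagonal_above k n w"
  shows "signed_cone_sum (tridiagonal_refinement k n w) (indicat_real (gen_cone n w))"
  using assms(2-)
proof (induction k arbitrary: w)
  case 0
  then show ?case
    unfolding tridiagonal_refinement_def
    by (intro signed_cone_sum_indicat exI[of _ w]) simp
next
  case (Suc k w)
  have lift: "signed_cone_sum (tridiagonal_refinement (Suc k) n w) (indicat_real (gen_cone n u))"
    if u: "unit_basis n u" "tridiagonal_above k n u" "\<And>j. k < j \<Longrightarrow> j \<le> n \<Longrightarrow> u j = w j"
      "span (u ` {1..k}) = span (w ` {1..k})" for u
  proof (rule signed_cone_sum_mono)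
    show "signed_cone_sum (tridiagonal_refinement k n u) (indicat_real (gen_cone n u))"
      using Suc.IH[of u] Suc.prems(1) u(1,2) by simp
    show "tridiagonal_refinement (Suc k) n w C" if "tridiagonal_refinement k n u C" for C
      using tridiagonal_refinement_Suc[OF that Suc.prems(1) u(3,4)] .
  qed
  show ?case
  proof (cases "\<exists>i\<in>{1..k - 1}. w i \<bullet> w (Suc k) \<noteq> 0")
    case False
    have "tridiagonal_above k n w"
      unfolding tridiagonal_above_def
    proof (intro allI impI, elim conjE)
      fix l j assume l: "1 \<le> l" "l + 2 \<le> j" "k < j" "j \<le> n"
      show "w l \<bullet> w j = 0"
      proof (cases "j = Suc k")
        case True
        then have "l \<in> {1..k - 1}" using l by simp
        with False True show ?thesis by blast
      next
        case False
        then have "Suc k < j" using l by simp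
        with Suc.prems(3) l show ?thesis unfolding tridiagonal_above_def by blast
      qed
    qed
    then show ?thesis using lift[of w] Suc.prems(2) by simp
  next
    case True
    then obtain i\<^sub>0 where i\<^sub>0: "i\<^sub>0 \<in> {1..k}" "w i\<^sub>0 \<bullet> w (Suc k) \<noteq> 0" by force
    \<comment> \<open>The sign makes some coefficient positive, without which the decomposition fails.\<close>
    define \<sigma> where "\<sigma> = sgn (w i\<^sub>0 \<bullet> w (Suc k))"
    \<comment> \<open>Zero coefficients beyond \<open>k\<close> keep the cleared columns intact and
      confine the pieces to indices \<open>i \<le> k\<close>.\<close>
    define a where "a l = (if l \<in> {1..k} then \<sigma> * (w l \<bullet> w (Suc k)) else 0)" for l
    let ?I = "{i \<in> {1..n}. a i \<noteq> 0}"
    have \<sigma>: "\<sigma> \<noteq> 0" using i\<^sub>0 by (simp add: \<sigma>_def sgn_if)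
    have "\<exists>i\<in>{1..n}. 0 < a i"
      using i\<^sub>0 Suc.prems(1) by (intro bexI[of _ i\<^sub>0]) (auto simp: a_def \<sigma>_def sgn_if)
    then have "equiv_mod_lines (indicat_real (gen_cone n w))
        (\<lambda>x. \<Sum>i\<in>?I. sgn (a i) * indicat_real (gen_cone n (shear w a i)) x)"
      using Suc.prems(2) unfolding unit_basis_def by (intro gen_cone_signed_decomposition[OF n]) blast+
    moreover have "signed_cone_sum (tridiagonal_refinement (Suc k) n w)
        (indicat_real (gen_cone n (shear w a i)))"
      if "i \<in> ?I" for i
    proof -
      have i: "i \<in> {1..k}" "a i \<noteq> 0" using that by (auto simp: a_def split: if_splits)
      have a: "a l = \<sigma> * (w l \<bullet> w (Suc k))" if "l \<in> {1..k}" for l using that by (simp add: a_def)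
      have a0: "a l = 0" if "k < l" for l using that by (simp add: a_def)
      note v = tridiagonal_above_shear[OF n Suc.prems a a0 \<sigma> i]
      show ?thesis using lift[OF v(1,2,4,5)] v(3) by simp
    qed
    then have "signed_cone_sum (tridiagonal_refinement (Suc k) n w)
        (\<lambda>x. \<Sum>i\<in>?I. sgn (a i) * indicat_real (gen_cone n (shear w a i)) x)"
      by (intro signed_cone_sum_sum signed_cone_sum_sign) (auto simp: sgn_if)
    ultimately show ?thesis by (rule signed_cone_sum_equiv)
  qed
qed

section \<open>Signs and positive definiteness\<close>

text \<open>The constraints couple only consecutive signs, so each sign can be chosen from its
  predecessor without conflict.\<close>

lemma signs_with_nonpositive_products:
  fixes c :: "nat \<Rightarrow> real"
  obtains \<epsilon> where "\<And>i. \<epsilon> i \<in> {1, -1}" "\<And>i. \<epsilon> i * \<epsilon> (Suc i) * c i = - \<bar>c i\<bar>"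
proof -
  have "\<exists>\<epsilon>. \<forall>i. \<epsilon> i \<in> {1, -1 :: real} \<and> \<epsilon> i * \<epsilon> (Suc i) * c i = - \<bar>c i\<bar>"
  proof (rule dependent_nat_choice)
    show "\<exists>x. x \<in> {1, -1 :: real}" by auto
    fix x :: real and i assume "x \<in> {1, -1}"
    then show "\<exists>y. y \<in> {1, -1} \<and> x * y * c i = - \<bar>c i\<bar>"
      by (intro exI[of _ "if 0 \<le> x * c i then -1 else 1"]) auto
  qed
  then show ?thesis using that by blast
qed

lemma columns_mult_eq_sum: "columns_mult n u x = (\<Sum>j=1..n. x j *\<^sub>R u j)"
  by (simp add: columns_mult_def vec_eq_iff sum_component mult.commute)

text \<open>With suitable signs the associated matrix is the Gram matrix of the vectors
  \<open>\<epsilon> i *\<^sub>R v i\<close>. Its quadratic form is therefore a squared norm,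
  positive because these vectors are independent.\<close>

lemma tridiagonal_assoc_matrix:
  fixes v :: "nat \<Rightarrow> 'a::euclidean_space"
  assumes n: "n = DIM('a)" and v: "unit_basis n v" "tridiagonal_above 0 n v"
  obtains \<epsilon> where "\<And>i. \<epsilon> i \<in> {1, -1}"
    "\<And>x. quad_form n (assoc_matrix v) x = (norm (\<Sum>j=1..n. x j *\<^sub>R (\<epsilon> j *\<^sub>R v j)))\<^sup>2"
    "pos_definite n (assoc_matrix v)"
proof -
  obtain \<epsilon> where \<epsilon>: "\<And>i. \<epsilon> i \<in> {1, -1 :: real}"
    "\<And>i. \<epsilon> i * \<epsilon> (Suc i) * (v i \<bullet> v (Suc i)) = - \<bar>v i \<bullet> v (Suc i)\<bar>"
    using signs_with_nonpositive_products[of "\<lambda>i. v i \<bullet> v (Suc i)"] by blast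
  have sym: "assoc_matrix v i j = assoc_matrix v j i" for i j
    by (simp add: assoc_matrix_def inner_commute)
  have upper: "assoc_matrix v i j = \<epsilon> i * \<epsilon> j * (v i \<bullet> v j)"
    if "1 \<le> i" "i \<le> j" "j \<le> n" for i j
  proof -
    consider "j = i" | "j = Suc i" | "i + 2 \<le> j" using \<open>i \<le> j\<close> by linarith
    then show ?thesis
    proof cases
      case 1
      have "v i \<bullet> v i = 1" using v(1) that by (simp add: unit_basis_def dot_square_norm)
      then show ?thesis using 1 \<epsilon>(1)[of i] by (auto simp: assoc_matrix_def)
    next
      case 2
      then show ?thesis using \<epsilon>(2)[of i] by (simp add: assoc_matrix_def)
    next
      case 3
      then have "v i \<bullet> v j = 0" using v(2) that by (simp add: tridiagonal_above_def)
      then show ?thesis using 3 by (simp add: assoc_matrix_def)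
    qed
  qed
  have entry: "assoc_matrix v i j = \<epsilon> i * \<epsilon> j * (v i \<bullet> v j)"
    if "i \<in> {1..n}" "j \<in> {1..n}" for i j
    using upper[of i j] upper[of j i] sym[of i j] that
    by (cases "i \<le> j") (auto simp: inner_commute mult_ac)
  have quad: "quad_form n (assoc_matrix v) x = (norm (\<Sum>j=1..n. x j *\<^sub>R (\<epsilon> j *\<^sub>R v j)))\<^sup>2" for x
    unfolding quad_form_def power2_norm_eq_inner inner_sum_left inner_sum_right sum_distrib_left
    by (intro sum.cong refl) (auto simp: entry inner_commute algebra_simps)
  have "pos_definite n (assoc_matrix v)"
    unfolding pos_definite_def
  proof (intro conjI allI impI ballI sym)
    fix x :: "nat \<Rightarrow> real" assume "\<exists>i\<in>{1..n}. x i \<noteq> 0"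
    then obtain i where i: "i \<in> {1..n}" "x i \<noteq> 0" by blast
    have span: "span (v ` {1..n}) = UNIV" using v(1) by (simp add: unit_basis_def)
    obtain y where dual: "\<And>i j. i \<in> {1..n} \<Longrightarrow> j \<in> {1..n} \<Longrightarrow> y i \<bullet> v j = (if i = j then 1 else 0)"
      using dual_basis_exists[OF spanning_family_basis[OF _ _ span]] n by auto
    \<comment> \<open>Pairing with a dual vector recovers \<open>x i\<close> up to sign, so the
      combination is nonzero.\<close>
    have "y i \<bullet> (\<Sum>j=1..n. x j *\<^sub>R (\<epsilon> j *\<^sub>R v j)) = x i * \<epsilon> i"
      unfolding scaleR_scaleR
      by (rule dual_basis_coordinate(1)[OF finite_atLeastAtMost i(1) dual])
    also have "\<dots> \<noteq> 0" using i \<epsilon>(1)[of i] by auto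
    finally show "0 < quad_form n (assoc_matrix v) x"
      unfolding quad by auto
  qed
  then show ?thesis using that \<epsilon>(1) quad by blast
qed

theorem theorem2p5:
  fixes w :: "nat \<Rightarrow> real ^ 'n" and n :: nat
  assumes n: "n = CARD('n)"
    and indep: "inj_on w {1..n}" "independent (w ` {1..n})"
    and unit: "\<forall>i\<in>{1..n}. norm (w i) = 1"
  shows "\<exists>(N::nat) (C :: nat \<Rightarrow> (real ^ 'n) set) (s :: nat \<Rightarrow> real).
     (\<forall>m\<in>{1..N}. s m \<in> {1, -1}) \<and>
     equiv_mod_lines (indicat_real (gen_cone n w))
        (\<lambda>x. \<Sum>m=1..N. s m * indicat_real (C m) x) \<and>
     (\<forall>m\<in>{1..N}.
        (polyhedral_cone (C m) \<and> contains_lines (C m)) \<or>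
        (\<exists>v :: nat \<Rightarrow> real ^ 'n.
           C m = gen_cone n v \<and> dim (C m) = n \<and>
           pos_definite n (assoc_matrix v) \<and>
           (\<forall>i\<in>{1..n}. norm (v i) = 1) \<and>
           v n = w n \<and>
           span (v ` {1..n-1}) = span (w ` {1..n-1}) \<and>
           (\<forall>i\<in>{1..n-2}. v i \<bullet> v n = 0) \<and>
           (\<exists>\<epsilon> :: nat \<Rightarrow> real. (\<forall>i\<in>{1..n}. \<epsilon> i \<in> {1, -1}) \<and>
              (\<forall>x :: nat \<Rightarrow> real.
                 quad_form n (assoc_matrix v) x =
                 (norm (columns_mult n (\<lambda>i. \<epsilon> i *\<^sub>R v i) x))\<^sup>2))))"
proof -
  have DIM: "n = DIM(real ^ 'n)" using n by simp
  have "card (w ` {1..n}) = DIM(real ^ 'n)" using indep(1) DIM by (simp add: card_image)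
  then have "span (w ` {1..n}) = UNIV"
    using card_ge_dim_independent[of "w ` {1..n}" UNIV] indep(2) by auto
  then have w: "unit_basis n w" using unit by (simp add: unit_basis_def)
  \<comment> \<open>No column lies beyond \<open>n\<close>, so the induction can start from the
    given cone.\<close>
  have "tridiagonal_above n n w" by (simp add: tridiagonal_above_def)
  note tridiagonal_decomposition[OF DIM order_refl w this]
  then obtain N :: nat and C and s :: "nat \<Rightarrow> real"
    where Cs: "\<forall>m\<in>{1..N}. s m \<in> {1, -1} \<and> tridiagonal_refinement n n w (C m)"
      and equiv: "equiv_mod_lines (indicat_real (gen_cone n w))
        (\<lambda>x. \<Sum>m=1..N. s m * indicat_real (C m) x)"
    unfolding signed_cone_sum_def by (elim exE conjE) (rule that)
  have "\<exists>v :: nat \<Rightarrow> real ^ 'n.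
           C m = gen_cone n v \<and> dim (C m) = n \<and>
           pos_definite n (assoc_matrix v) \<and>
           (\<forall>i\<in>{1..n}. norm (v i) = 1) \<and>
           v n = w n \<and>
           span (v ` {1..n-1}) = span (w ` {1..n-1}) \<and>
           (\<forall>i\<in>{1..n-2}. v i \<bullet> v n = 0) \<and>
           (\<exists>\<epsilon> :: nat \<Rightarrow> real. (\<forall>i\<in>{1..n}. \<epsilon> i \<in> {1, -1}) \<and>
              (\<forall>x :: nat \<Rightarrow> real.
                 quad_form n (assoc_matrix v) x =
                 (norm (columns_mult n (\<lambda>i. \<epsilon> i *\<^sub>R v i) x))\<^sup>2))"
    if m: "m \<in> {1..N}" for m
  proof -
    obtain v where v: "C m = gen_cone n v" "unit_basis n v" "tridiagonal_above 0 n v"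
      "\<And>j. n \<le> j \<Longrightarrow> 1 \<le> j \<Longrightarrow> j \<le> n \<Longrightarrow> v j = w j"
      "span (v ` {1..n - 1}) = span (w ` {1..n - 1})"
      using bspec[OF Cs m] unfolding tridiagonal_refinement_def by blast
    obtain \<epsilon> where \<epsilon>: "\<And>i. \<epsilon> i \<in> {1, -1}"
      "\<And>x. quad_form n (assoc_matrix v) x = (norm (\<Sum>j=1..n. x j *\<^sub>R (\<epsilon> j *\<^sub>R v j)))\<^sup>2"
      "pos_definite n (assoc_matrix v)"
      by (rule tridiagonal_assoc_matrix[OF DIM v(2,3)], rule that)
    \<comment> \<open>The cone contains its generators, which already span the space.\<close>
    have "v ` {1..n} \<subseteq> gen_cone n v" by (simp add: gen_cone_eq_hull hull_subset)
    then have "span (C m) = UNIV"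
      using v(1,2) span_mono[of "v ` {1..n}" "C m"] by (auto simp: unit_basis_def)
    then have "dim (C m) = n" using DIM dim_span[of "C m"] by simp
    moreover have "v n = w n" using v(4)[of n] n by (simp add: Suc_leI)
    moreover have "\<forall>i\<in>{1..n-2}. v i \<bullet> v n = 0"
    proof
      fix i assume "i \<in> {1..n-2}"
      then have "1 \<le> i" "i + 2 \<le> n" "0 < n" by auto
      then show "v i \<bullet> v n = 0" using v(3) by (simp add: tridiagonal_above_def)
    qed
    moreover have "\<forall>i\<in>{1..n}. norm (v i) = 1" using v(2) by (simp add: unit_basis_def)
    moreover have "\<forall>i\<in>{1..n}. \<epsilon> i \<in> {1, -1}" using \<epsilon>(1) by blast
    ultimately show ?thesis
      unfolding columns_mult_eq_sum
      by (intro exI[of _ v] conjI exI[of _ \<epsilon>] allI v(1,5) \<epsilon>(2,3))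
  qed
  moreover have "s m \<in> {1, -1}" if "m \<in> {1..N}" for m using Cs that by blast
  ultimately show ?thesis
    \<comment> \<open>Cones containing lines are absorbed in \<open>equiv\<close>, so every listed
      cone satisfies the second alternative.\<close>
    using equiv by (intro exI[of _ N] exI[of _ C] exI[of _ s] conjI ballI disjI2)
qed

end
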